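(* For every integer $r\ge 3$ and every real $t\in(0,1]$, \[\frac1r+\left(1-\frac1r\right)t\ \le\ \delta(r,t)\ \le\ \frac12+\frac t2.\]
   Context: An edge weighting of the complete graph $K_n$ is a function $w\colon E(K_n)\to[0,1]$. The weighted degree $\deg_w(v)$ of a vertex $v$ is the sum of the weights of the edges incident to $v$, and $\delta_w(K_n)=\min_v \deg_w(v)$. A $K_r$-factor of $K_n$ is a collection of $n/r$ vertex-disjoint copies of $K_r$ covering all vertices; the weight of a copy of $K_r$ is the sum of the weights of its $\binom{r}{2}$ edges. For $n\in r\mathbb{Z}$, let $\mathcal{W}(r,t,n)$ be the set of edge weightings of $K_n$ such that every $K_r$-factor contains a clique of weight strictly smaller than $t\binom{r}{2}$. Define $\delta(r,t,n)=\sup_{w\in\mathcal{W}(r,t,n)}\delta_w(K_n)$ and $\delta(r,t)=\limsup_{n\to\infty}\delta(r,t,n)/n$ (over $n$ divisible by $r$). *)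

theory Defs
  imports Complex_Main "HOL-Library.FuncSet" "HOL-Library.Disjoint_Sets"
    "HOL-Library.Ramsey" "HOL-Library.Extended_Real"
begin

text \<open>
  The complete graph \<open>K\<^sub>n\<close> has vertex set \<open>{..<n}\<close> and edge set \<open>nsets {..<n} 2\<close>;
  a copy of \<open>K\<^sub>r\<close> in it is identified with its vertex set.
\<close>

definition edge_weightings :: "nat \<Rightarrow> (nat set \<Rightarrow> real) set" where
  "edge_weightings n = nsets {..<n} 2 \<rightarrow>\<^sub>E {0..1}"

definition weighted_degree :: "nat \<Rightarrow> (nat set \<Rightarrow> real) \<Rightarrow> nat \<Rightarrow> real" where
  "weighted_degree n w v = (\<Sum>e | e \<in> nsets {..<n} 2 \<and> v \<in> e. w e)"

definition min_weighted_degree :: "nat \<Rightarrow> (nat set \<Rightarrow> real) \<Rightarrow> real" where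
  "min_weighted_degree n w = Min (weighted_degree n w ` {..<n})"

definition clique_weight :: "(nat set \<Rightarrow> real) \<Rightarrow> nat set \<Rightarrow> real" where
  "clique_weight w C = (\<Sum>e \<in> nsets C 2. w e)"

definition clique_factor :: "nat \<Rightarrow> nat \<Rightarrow> nat set set \<Rightarrow> bool" where
  "clique_factor r n F \<longleftrightarrow> partition_on {..<n} F \<and> (\<forall>C\<in>F. card C = r)"

definition bad_weightings :: "nat \<Rightarrow> real \<Rightarrow> nat \<Rightarrow> (nat set \<Rightarrow> real) set" where
  "bad_weightings r t n =
     {w \<in> edge_weightings n.
        \<forall>F. clique_factor r n F \<longrightarrow> (\<exists>C\<in>F. clique_weight w C < t * real (r choose 2))}"

definition delta_n :: "nat \<Rightarrow> real \<Rightarrow> nat \<Rightarrow> real" where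
  "delta_n r t n = (SUP w\<in>bad_weightings r t n. min_weighted_degree n w)"

definition delta :: "nat \<Rightarrow> real \<Rightarrow> ereal" where
  "delta r t =
     Limsup (inf sequentially (principal {n. r dvd n})) (\<lambda>n. ereal (delta_n r t n / real n))"

text \<open>
  For \<open>n > 0\<close>, \<open>r \<ge> 2\<close> and \<open>t > 0\<close> the real supremum in \<open>delta_n\<close> is over a nonempty
  bounded set. The degenerate case \<open>n = 0\<close> is irrelevant for the limit superior.
\<close>

lemma bad_weightings_nonempty:
  assumes "n > 0" "r \<ge> 2" "t > 0"
  shows "bad_weightings r t n \<noteq> {}"
proof -
  let ?w = "\<lambda>e\<in>nsets {..<n} 2. 0 :: real"
  have "\<exists>C\<in>F. clique_weight ?w C < t * real (r choose 2)" if F: "clique_factor r n F" for F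
  proof -
    from F have U: "\<Union>F = {..<n}"
      by (auto simp: clique_factor_def partition_on_def)
    with assms(1) obtain C where C: "C \<in> F" by fastforce
    have "nsets C 2 \<subseteq> nsets {..<n} 2"
      using C U by (intro nsets_mono) auto
    then have "clique_weight ?w C = 0"
      unfolding clique_weight_def by (intro sum.neutral) auto
    moreover have "0 < t * real (r choose 2)"
      using assms by (simp add: zero_less_binomial_iff)
    ultimately show ?thesis using C by (intro bexI[of _ C]) simp_all
  qed
  then have "?w \<in> bad_weightings r t n"
    by (auto simp: bad_weightings_def edge_weightings_def)
  then show ?thesis by blast
qed

lemma bdd_above_min_weighted_degree:
  assumes "n > 0"
  shows "bdd_above (min_weighted_degree n ` bad_weightings r t n)"
proof (rule bdd_aboveI2)
  fix w assume "w \<in> bad_weightings r t n"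
  then have w: "w e \<le> 1" if "e \<in> nsets {..<n} 2" for e
    using that by (auto simp: bad_weightings_def edge_weightings_def PiE_iff)
  have "min_weighted_degree n w \<le> weighted_degree n w 0"
    unfolding min_weighted_degree_def using assms by (intro Min_le) auto
  also have "\<dots> \<le> (\<Sum>e | e \<in> nsets {..<n} 2 \<and> 0 \<in> e. 1)"
    unfolding weighted_degree_def using w by (intro sum_mono) auto
  finally show "min_weighted_degree n w \<le> (\<Sum>e | e \<in> nsets {..<n} 2 \<and> 0 \<in> e. 1)" .
qed

end

theory Submission imports Defs "HOL-Combinatorics.Permutations" "HOL-Real_Asymp.Real_Asymp" begin

text \<open>
  Lower bound: with \<open>n = m r\<close>, give weight \<open>1\<close> to all edges meeting a fixed set of \<open>m - 1\<close> vertices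
  and weight slightly below \<open>t\<close> to all others; some clique of any factor misses that set.

  Upper bound: split the vertices into parts \<open>V\<^sub>0, \<dots>, V\<^sub>r\<^sub>-\<^sub>1\<close> of size \<open>m\<close> such that every vertex
  has weighted degree at least \<open>(1/2 + t/2) m\<close> into each of them. For this, cut the vertices into
  \<open>m\<close> blocks of \<open>r\<close> and distribute each block over the parts by an independent random cyclic shift,
  derandomised here. Then grow cliques part by part: weighting a pair of a partial clique \<open>C\<close> and a
  vertex \<open>v\<close> of the next part by the average of \<open>w\<close> over the edges between them gives a bipartite
  graph with weighted degrees at least \<open>(1/2 + t/2) m\<close>, whose pairs of weight at least \<open>t\<close> have
  minimum degree at least \<open>m/2\<close> and hence contain a perfect matching. Adding the \<open>k\<close>-th vertex thus
  contributes at least \<open>t k\<close> to each clique.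
\<close>

section \<open>Weighted degrees and clique weights as sums over vertices\<close>

text \<open>The value 0 on the diagonal lets degree sums run over all vertices, or over a whole
  part, without excluding the vertex itself.\<close>

definition edge_val :: "(nat set \<Rightarrow> real) \<Rightarrow> nat \<Rightarrow> nat \<Rightarrow> real" where
  "edge_val w u v = (if u = v then 0 else w {u, v})"

lemma edge_val_commute: "edge_val w u v = edge_val w v u"
  by (simp add: edge_val_def insert_commute)

lemma edge_val_bounds:
  assumes "w \<in> edge_weightings n" "u < n" "v < n"
  shows "0 \<le> edge_val w u v" "edge_val w u v \<le> 1"
proof -
  have "w {u, v} \<in> {0..1}" if "u \<noteq> v"
  proof -
    have "{u, v} \<in> nsets {..<n} 2"
      using assms that by (auto simp: nsets_def)
    then show ?thesis using assms(1) by (auto simp: edge_weightings_def)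
  qed
  then show "0 \<le> edge_val w u v" "edge_val w u v \<le> 1"
    by (auto simp: edge_val_def)
qed

lemma weighted_degree_eq_sum_edge_val:
  assumes "v < n"
  shows "weighted_degree n w v = (\<Sum>u<n. edge_val w v u)"
proof -
  have eq: "{e. e \<in> nsets {..<n} 2 \<and> v \<in> e} = (\<lambda>u. {v, u}) ` ({..<n} - {v})"
    using assms by (auto simp: nsets_def card_2_iff)
  have "inj_on (\<lambda>u. {v, u}) ({..<n} - {v})"
    by (auto simp: inj_on_def doubleton_eq_iff)
  then have "weighted_degree n w v = (\<Sum>u\<in>{..<n} - {v}. w {v, u})"
    unfolding weighted_degree_def eq by (simp add: sum.reindex)
  also have "\<dots> = (\<Sum>u\<in>{..<n} - {v}. edge_val w v u)"
    by (intro sum.cong) (auto simp: edge_val_def)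
  also have "\<dots> = (\<Sum>u<n. edge_val w v u)"
    by (intro sum.mono_neutral_left) (auto simp: edge_val_def)
  finally show ?thesis .
qed

text \<open>Each edge is counted at the later of its two ends in the order given by
  \<open>f\<close>. This matches cliques that are built one vertex at a time, with the inner sum as
  the gain from the \<open>j\<close>-th vertex.\<close>

lemma clique_weight_image:
  fixes f :: "nat \<Rightarrow> nat"
  assumes "inj_on f {..<r}"
  shows "clique_weight w (f ` {..<r}) = (\<Sum>j<r. \<Sum>i<j. edge_val w (f j) (f i))"
  using assms
proof (induction r)
  case 0
  then show ?case by (simp add: clique_weight_def nsets_eq_empty)
next
  case (Suc r)
  let ?A = "f ` {..<r}"
  have nin: "f r \<notin> ?A" using Suc.prems by (auto dest: inj_onD)
  have inj: "inj_on f {..<r}" using Suc.prems by (rule inj_on_subset) auto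
  have eq: "nsets (insert (f r) ?A) 2 = nsets ?A 2 \<union> (\<lambda>u. {f r, u}) ` ?A"
    using nin by (auto simp: nsets_def card_2_iff)
  have fin: "finite (nsets ?A 2)" by (simp add: finite_imp_finite_nsets)
  have "inj_on (\<lambda>i. {f r, f i}) {..<r}"
    using inj by (auto simp: inj_on_def doubleton_eq_iff)
  then have "(\<Sum>e\<in>(\<lambda>u. {f r, u}) ` ?A. w e) = (\<Sum>i<r. w {f r, f i})"
    by (simp add: image_image sum.reindex)
  also have "\<dots> = (\<Sum>i<r. edge_val w (f r) (f i))"
    using nin by (intro sum.cong) (auto simp: edge_val_def)
  finally have 1: "(\<Sum>e\<in>(\<lambda>u. {f r, u}) ` ?A. w e) = (\<Sum>i<r. edge_val w (f r) (f i))" .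
  have "nsets ?A 2 \<inter> (\<lambda>u. {f r, u}) ` ?A = {}"
    using nin by (auto simp: nsets_def)
  then have "clique_weight w (f ` {..<Suc r})
      = clique_weight w ?A + (\<Sum>e\<in>(\<lambda>u. {f r, u}) ` ?A. w e)"
    unfolding clique_weight_def lessThan_Suc image_insert eq
    using fin by (intro sum.union_disjoint) auto
  then show ?case using Suc.IH[OF inj] 1 by simp
qed

section \<open>Perfect matchings from averaged degrees\<close>

text \<open>Take a permutation with the most indices satisfying \<open>P i (p i)\<close>. If
  \<open>a\<close> fails, then the indices whose partner suits \<open>a\<close> and the indices that
  suit \<open>p a\<close> form two sets of size at least \<open>m/2\<close>, both avoiding
  \<open>a\<close>, so they meet in some \<open>b\<close>. Swapping the partners of \<open>a\<close>
  and \<open>b\<close> makes both good and changes nothing else.\<close>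

lemma perfect_matching_of_half_degrees:
  fixes P :: "nat \<Rightarrow> nat \<Rightarrow> bool"
  assumes row: "\<And>i. i < m \<Longrightarrow> m \<le> 2 * card {g\<in>{..<m}. P i g}"
    and col: "\<And>g. g < m \<Longrightarrow> m \<le> 2 * card {i\<in>{..<m}. P i g}"
  shows "\<exists>p. p permutes {..<m} \<and> (\<forall>i<m. P i (p i))"
proof -
  define good where "good = (\<lambda>p. {i\<in>{..<m}. P i (p i)})"
  have "\<exists>p. p permutes {..<m} \<and> (\<forall>q. q permutes {..<m} \<longrightarrow> card (good q) \<le> card (good p))"
  proof (rule ex_has_greatest_nat)
    show "id permutes {..<m}" by (rule permutes_id)
    show "\<forall>q. q permutes {..<m} \<longrightarrow> card (good q) < Suc m"
    proof (intro allI impI)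
      fix q
      have "card (good q) \<le> card {..<m}"
        unfolding good_def by (intro card_mono) auto
      then show "card (good q) < Suc m" by simp
    qed
  qed
  then obtain p where p: "p permutes {..<m}"
    and max: "\<And>q. q permutes {..<m} \<Longrightarrow> card (good q) \<le> card (good p)" by blast
  have "P a (p a)" if a: "a < m" for a
  proof (rule ccontr)
    assume bad: "\<not> P a (p a)"
    have pa: "p a < m" using permutes_in_image[OF p, of a] a by simp
    \<comment> \<open>Exchanging the partners of \<open>a\<close> and of an element of \<open>?R \<inter> ?C\<close> improves \<open>p\<close>.\<close>
    let ?R = "{i\<in>{..<m}. P a (p i)}" and ?C = "{i\<in>{..<m}. P i (p a)}"
    have "p ` ?R = {g\<in>{..<m}. P a g}"
    proof
      show "p ` ?R \<subseteq> {g\<in>{..<m}. P a g}"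
        using permutes_in_image[OF p] by auto
      show "{g\<in>{..<m}. P a g} \<subseteq> p ` ?R"
      proof
        fix g assume g: "g \<in> {g\<in>{..<m}. P a g}"
        then obtain i where "i < m" "g = p i"
          using permutes_image[OF p] by (metis (no_types, lifting) imageE lessThan_iff mem_Collect_eq)
        then show "g \<in> p ` ?R" using g by auto
      qed
    qed
    moreover have "inj_on p ?R" using permutes_inj[OF p] by (rule inj_on_subset) auto
    ultimately have cR: "m \<le> 2 * card ?R" using row[OF a] by (metis card_image)
    have cC: "m \<le> 2 * card ?C" by (rule col[OF pa])
    have "card (?R \<union> ?C) \<le> card ({..<m} - {a})"
      using bad by (intro card_mono) auto
    also have "\<dots> < m" using a by simp
    finally have "?R \<inter> ?C \<noteq> {}"
      using cR cC card_Un_disjoint[of ?R ?C] by fastforce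
    then obtain b where b: "b < m" "P a (p b)" "P b (p a)" by auto
    define q where "q = p \<circ> transpose a b"
    have q: "q permutes {..<m}"
      unfolding q_def using a b(1) p by (intro permutes_compose permutes_swap_id) auto
    have "insert a (good p) \<subseteq> good q"
      using a b by (auto simp: good_def q_def transpose_def)
    moreover have "a \<notin> good p" using bad by (simp add: good_def)
    moreover have "finite (good p)" "finite (good q)" by (auto simp: good_def)
    ultimately have "card (good p) < card (good q)"
      by (metis Suc_le_lessD card_insert_disjoint card_mono)
    with max[OF q] show False by simp
  qed
  with p show ?thesis by blast
qed

text \<open>This is the source of the constant \<open>1/2 + t/2\<close>, the mean of 1 and
  \<open>t\<close>: if fewer than half of the entries reach \<open>t\<close>, bounding those by 1
  and the others by \<open>t\<close> keeps the sum below \<open>(1/2 + t/2) * m\<close>.\<close>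

lemma half_entries_above_threshold:
  fixes f :: "nat \<Rightarrow> real"
  assumes "t \<le> 1" and le1: "\<And>g. g < m \<Longrightarrow> f g \<le> 1"
    and sum: "(1/2 + t/2) * real m \<le> (\<Sum>g<m. f g)"
  shows "m \<le> 2 * card {g\<in>{..<m}. t \<le> f g}"
proof (rule ccontr)
  let ?G = "{g\<in>{..<m}. t \<le> f g}" and ?N = "{g\<in>{..<m}. \<not> t \<le> f g}"
  assume "\<not> ?thesis"
  then have lt: "2 * card ?G < m" by simp
  have U: "{..<m} = ?G \<union> ?N" by auto
  have card: "card ?G + card ?N = m"
    using card_Un_disjoint[of ?G ?N] U by (metis (no_types, lifting) card_lessThan disjoint_iff
        finite_Un finite_lessThan mem_Collect_eq)
  then have "card ?N > 0" using lt by linarith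
  then have ne: "?N \<noteq> {}" by (metis card.empty less_irrefl)
  have "(\<Sum>g<m. f g) = (\<Sum>g\<in>?G. f g) + (\<Sum>g\<in>?N. f g)"
    by (subst U, rule sum.union_disjoint) auto
  also have "(\<Sum>g\<in>?G. f g) \<le> (\<Sum>g\<in>?G. 1)" using le1 by (intro sum_mono) auto
  also have "(\<Sum>g\<in>?N. f g) < (\<Sum>g\<in>?N. t)" using ne by (intro sum_strict_mono) auto
  finally have "(\<Sum>g<m. f g) < real (card ?G) + real (card ?N) * t" by simp
  also have "real (card ?N) = real m - real (card ?G)" using card by linarith
  finally have "(\<Sum>g<m. f g) < t * m + (1 - t) * real (card ?G)" by (simp add: algebra_simps)
  also have "\<dots> \<le> t * m + (1 - t) * (real m / 2)"
    using assms(1) lt by (intro add_left_mono mult_left_mono) auto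
  finally show False using sum by (simp add: field_simps)
qed

section \<open>Growing transversal cliques part by part\<close>

text \<open>Here \<open>p j g\<close> is the \<open>g\<close>-th vertex of part \<open>j\<close>,
  and \<open>q j i\<close> is the position in part \<open>j\<close> of the vertex that joins the
  \<open>i\<close>-th clique. Induction on \<open>k\<close> matches the partial cliques with the
  vertices of part \<open>k\<close>.\<close>

lemma transversal_cliques:
  fixes W :: "nat \<Rightarrow> nat \<Rightarrow> real" and p :: "nat \<Rightarrow> nat \<Rightarrow> nat"
  assumes "t \<le> 1" and sym: "\<And>x y. W x y = W y x"
    and le1: "\<And>i j g h. \<lbrakk>i < r; j < r; g < m; h < m\<rbrakk> \<Longrightarrow> W (p i g) (p j h) \<le> 1"
    and deg: "\<And>i j g. \<lbrakk>i < r; j < r; g < m\<rbrakk> \<Longrightarrow> (1/2 + t/2) * real m \<le> (\<Sum>h<m. W (p i g) (p j h))"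
    and "k \<le> r"
  shows "\<exists>q. (\<forall>j<k. q j permutes {..<m}) \<and>
    (\<forall>j<k. \<forall>i<m. t * real j \<le> (\<Sum>l<j. W (p j (q j i)) (p l (q l i))))"
  using \<open>k \<le> r\<close>
proof (induction k)
  case 0
  then show ?case by simp
next
  case (Suc k)
  then obtain q where q: "\<And>j. j < k \<Longrightarrow> q j permutes {..<m}"
    and qW: "\<And>j i. j < k \<Longrightarrow> i < m \<Longrightarrow> t * real j \<le> (\<Sum>l<j. W (p j (q j i)) (p l (q l i)))"
    by auto
  have kr: "k < r" using Suc.prems by simp
  have qm: "q j i < m" if "j < k" "i < m" for j i
    using permutes_in_image[OF q[OF that(1)], of i] that(2) by simp
  have "\<exists>s. s permutes {..<m} \<and> (\<forall>i<m. t * real k \<le> (\<Sum>l<k. W (p k (s i)) (p l (q l i))))"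
  proof (cases "k = 0")
    case True
    then show ?thesis by (auto intro!: exI[of _ id] permutes_id)
  next
    case False
    define b where "b = (\<lambda>i g. (\<Sum>l<k. W (p k g) (p l (q l i))) / real k)"
    have b1: "b i g \<le> 1" if "i < m" "g < m" for i g
    proof -
      have "(\<Sum>l<k. W (p k g) (p l (q l i))) \<le> (\<Sum>l<k. 1)"
        using that kr qm by (intro sum_mono le1) auto
      then show ?thesis using False by (simp add: b_def)
    qed
    have avg: "(1/2 + t/2) * real m \<le> (\<Sum>l<k. f l) / real k"
      if "\<And>l. l < k \<Longrightarrow> (1/2 + t/2) * real m \<le> f l" for f
    proof -
      have "(\<Sum>l<k. (1/2 + t/2) * real m) \<le> (\<Sum>l<k. f l)"
        using that by (intro sum_mono) auto
      then show ?thesis using False by (simp add: field_simps)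
    qed
    have row: "(1/2 + t/2) * real m \<le> (\<Sum>g<m. b i g)" if "i < m" for i
    proof -
      \<comment> \<open>Each member of clique \<open>i\<close> has large degree into part
        \<open>k\<close>, hence so does the average over the members.\<close>
      have "(1/2 + t/2) * real m \<le> (\<Sum>l<k. \<Sum>g<m. W (p l (q l i)) (p k g)) / real k"
        using that kr qm by (intro avg deg) auto
      also have "\<dots> = (\<Sum>g<m. b i g)"
        unfolding b_def sum_divide_distrib[symmetric]
        by (subst sum.swap) (simp add: sym[of "p k _"])
      finally show ?thesis .
    qed
    have col: "(1/2 + t/2) * real m \<le> (\<Sum>i<m. b i g)" if "g < m" for g
    proof -
      have "(1/2 + t/2) * real m \<le> (\<Sum>l<k. \<Sum>i<m. W (p k g) (p l i)) / real k"
        using that kr by (intro avg deg) auto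
      \<comment> \<open>As \<open>q l\<close> is a permutation, running over the cliques visits
        every vertex of part \<open>l\<close> exactly once.\<close>
      also have "(\<Sum>l<k. \<Sum>i<m. W (p k g) (p l i)) = (\<Sum>l<k. \<Sum>i<m. W (p k g) (p l (q l i)))"
      proof (rule sum.cong[OF refl])
        fix l assume "l \<in> {..<k}"
        then show "(\<Sum>i<m. W (p k g) (p l i)) = (\<Sum>i<m. W (p k g) (p l (q l i)))"
          using sum.permute[OF q, of l "\<lambda>i. W (p k g) (p l i)"] by (simp add: o_def)
      qed
      also have "\<dots> / real k = (\<Sum>i<m. b i g)"
        unfolding b_def sum_divide_distrib[symmetric] by (subst sum.swap) simp
      finally show ?thesis .
    qed
    have "\<exists>s. s permutes {..<m} \<and> (\<forall>i<m. t \<le> b i (s i))"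
      by (intro perfect_matching_of_half_degrees half_entries_above_threshold assms(1) b1 row col)
    then obtain s where "s permutes {..<m}" "\<And>i. i < m \<Longrightarrow> t \<le> b i (s i)" by blast
    then show ?thesis using False by (auto simp: b_def field_simps)
  qed
  then obtain s where s: "s permutes {..<m}"
    and sW: "\<And>i. i < m \<Longrightarrow> t * real k \<le> (\<Sum>l<k. W (p k (s i)) (p l (q l i)))" by blast
  have "t * real j \<le> (\<Sum>l<j. W (p j ((q(k := s)) j i)) (p l ((q(k := s)) l i)))"
    if "j < Suc k" "i < m" for j i
  proof -
    \<comment> \<open>Every \<open>l < j\<close> is below \<open>k\<close>, so the update affects
      only the vertex added last.\<close>
    have "(\<Sum>l<j. W (p j ((q(k := s)) j i)) (p l ((q(k := s)) l i)))
      = (\<Sum>l<j. W (p j ((q(k := s)) j i)) (p l (q l i)))"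
      using that by (intro sum.cong) auto
    then show ?thesis using qW sW that by (cases "j = k") auto
  qed
  moreover have "(q(k := s)) j permutes {..<m}" if "j < Suc k" for j
    using q s that by (cases "j = k") auto
  ultimately show ?case by blast
qed

section \<open>Derandomised choice with all sums near their means\<close>

text \<open>The method of conditional expectations: the potential on the left does not change on average
  when the next \<open>\<sigma> g\<close> is chosen uniformly at random.\<close>

lemma small_potential_choice:
  fixes X :: "nat \<Rightarrow> nat \<Rightarrow> 'k \<Rightarrow> real"
  assumes "r > 0" and zero: "\<And>g k. \<lbrakk>g < m; k \<in> K\<rbrakk> \<Longrightarrow> (\<Sum>s<r. X g s k) = 0"
  shows "\<exists>\<sigma>. (\<forall>g<m. \<sigma> g < r) \<and> (\<Sum>k\<in>K. \<Prod>g<m. 1 + X g (\<sigma> g) k) \<le> real (card K)"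
  using zero
proof (induction m)
  case 0
  then show ?case by simp
next
  case (Suc m)
  from Suc.IH Suc.prems obtain \<sigma> where \<sigma>: "\<And>g. g < m \<Longrightarrow> \<sigma> g < r"
    and le: "(\<Sum>k\<in>K. \<Prod>g<m. 1 + X g (\<sigma> g) k) \<le> real (card K)" by auto
  define P where "P = (\<lambda>k. \<Prod>g<m. 1 + X g (\<sigma> g) k)"
  have "\<exists>s<r. (\<Sum>k\<in>K. P k * (1 + X m s k)) \<le> (\<Sum>k\<in>K. P k)"
  proof (rule ccontr)
    assume "\<not> ?thesis"
    then have "(\<Sum>s<r. \<Sum>k\<in>K. P k) < (\<Sum>s<r. \<Sum>k\<in>K. P k * (1 + X m s k))"
      using assms(1) by (intro sum_strict_mono[of "{..<r}"]) (auto simp: not_le)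
    also have "\<dots> = (\<Sum>k\<in>K. P k * (real r + (\<Sum>s<r. X m s k)))"
      by (subst sum.swap) (simp add: sum_distrib_left[symmetric] sum.distrib)
    also have "\<dots> = (\<Sum>s<r. \<Sum>k\<in>K. P k)"
      using Suc.prems by (simp add: sum_distrib_left mult.commute)
    finally show False by simp
  qed
  then obtain s where s: "s < r" "(\<Sum>k\<in>K. P k * (1 + X m s k)) \<le> (\<Sum>k\<in>K. P k)" by blast
  have "(\<Prod>g<Suc m. 1 + X g ((\<sigma>(m := s)) g) k) = P k * (1 + X m s k)" for k
    by (simp add: P_def)
  then have "(\<Sum>k\<in>K. \<Prod>g<Suc m. 1 + X g ((\<sigma>(m := s)) g) k) \<le> real (card K)"
    using s(2) le by (simp add: P_def)
  moreover have "\<forall>g<Suc m. (\<sigma>(m := s)) g < r"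
    using \<sigma> s(1) by (auto simp: less_Suc_eq)
  ultimately show ?case by blast
qed

text \<open>A Chernoff-type argument with products of \<open>1 + X\<close> in place of exponentials.
  All factors are positive, so each single product is at most the whole potential, hence at most
  \<open>card K\<close>. Taking logarithms bounds the shortfall below the mean for every
  \<open>k\<close> at once.\<close>

lemma simultaneous_choice_near_mean:
  fixes a :: "nat \<Rightarrow> nat \<Rightarrow> 'k \<Rightarrow> real" and \<mu> :: "nat \<Rightarrow> 'k \<Rightarrow> real"
  assumes "finite K" "r > 0" and \<epsilon>: "0 < \<epsilon>" "\<epsilon> \<le> 1"
    and a: "\<And>g s k. \<lbrakk>g < m; s < r; k \<in> K\<rbrakk> \<Longrightarrow> 0 \<le> a g s k \<and> a g s k \<le> 1"
    and mean: "\<And>g k. \<lbrakk>g < m; k \<in> K\<rbrakk> \<Longrightarrow> (\<Sum>s<r. a g s k) = real r * \<mu> g k"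
    and large: "8 * ln (real (card K)) \<le> \<epsilon>\<^sup>2 * real m"
  shows "\<exists>\<sigma>. (\<forall>g<m. \<sigma> g < r) \<and> (\<forall>k\<in>K. (\<Sum>g<m. \<mu> g k) - \<epsilon> * real m \<le> (\<Sum>g<m. a g (\<sigma> g) k))"
proof -
  \<comment> \<open>The scale \<open>\<epsilon> / 4\<close> gives a loss of at most
    \<open>2 * (\<epsilon> / 4)\<^sup>2 = \<epsilon>\<^sup>2 / 8\<close> per index in
    \<open>ln (1 + x) \<ge> x - 2 * x\<^sup>2\<close>. Together with
    \<open>ln (card K) \<le> \<epsilon>\<^sup>2 * m / 8\<close> from \<open>large\<close>, the total
    is \<open>\<epsilon> / 4\<close> times the allowed shortfall
    \<open>\<epsilon> * m\<close>.\<close>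
  define X where "X = (\<lambda>g s k. \<epsilon> / 4 * (\<mu> g k - a g s k))"
  have \<mu>: "0 \<le> \<mu> g k \<and> \<mu> g k \<le> 1" if "g < m" "k \<in> K" for g k
  proof -
    have "0 \<le> (\<Sum>s<r. a g s k)" using a that by (intro sum_nonneg) auto
    moreover have "(\<Sum>s<r. a g s k) \<le> (\<Sum>s<r. 1)" using a that by (intro sum_mono) auto
    ultimately show ?thesis using mean[OF that] assms(2) by (simp add: zero_le_mult_iff)
  qed
  have absX: "\<bar>X g s k\<bar> \<le> \<epsilon> / 4" if "g < m" "s < r" "k \<in> K" for g s k
  proof -
    have "\<bar>\<mu> g k - a g s k\<bar> \<le> 1" using \<mu>[of g k] a[of g s k] that by linarith
    then show ?thesis using \<epsilon> by (simp add: X_def abs_mult mult_left_le)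
  qed
  have "\<exists>\<sigma>. (\<forall>g<m. \<sigma> g < r) \<and> (\<Sum>k\<in>K. \<Prod>g<m. 1 + X g (\<sigma> g) k) \<le> real (card K)"
  proof (rule small_potential_choice[OF assms(2)])
    fix g k assume "g < m" "k \<in> K"
    then have "(\<Sum>s<r. \<mu> g k - a g s k) = 0" using mean by (simp add: sum_subtractf)
    then show "(\<Sum>s<r. X g s k) = 0" by (simp only: X_def sum_distrib_left[symmetric])
  qed
  then obtain \<sigma> where \<sigma>: "\<And>g. g < m \<Longrightarrow> \<sigma> g < r"
    and le: "(\<Sum>k\<in>K. \<Prod>g<m. 1 + X g (\<sigma> g) k) \<le> real (card K)" by blast
  have "(\<Sum>g<m. \<mu> g k) - \<epsilon> * real m \<le> (\<Sum>g<m. a g (\<sigma> g) k)" if k: "k \<in> K" for k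
  proof -
    have pos: "0 < 1 + X g (\<sigma> g) l" if "g < m" "l \<in> K" for g l
      using absX[of g "\<sigma> g" l] \<sigma> that \<epsilon> by fastforce
    have "(\<Prod>g<m. 1 + X g (\<sigma> g) k) \<le> (\<Sum>k\<in>K. \<Prod>g<m. 1 + X g (\<sigma> g) k)"
      using pos assms(1) k by (intro member_le_sum prod_nonneg) (auto intro: less_imp_le)
    with le have "(\<Prod>g<m. 1 + X g (\<sigma> g) k) \<le> real (card K)" by linarith
    moreover have "0 < (\<Prod>g<m. 1 + X g (\<sigma> g) k)" using pos k by (intro prod_pos) auto
    ultimately have "ln (\<Prod>g<m. 1 + X g (\<sigma> g) k) \<le> ln (real (card K))"
      by (intro ln_mono) auto
    also have "ln (\<Prod>g<m. 1 + X g (\<sigma> g) k) = (\<Sum>g<m. ln (1 + X g (\<sigma> g) k))"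
      using pos k by (intro ln_prod) (auto simp: less_imp_neq[THEN not_sym])
    finally have "(\<Sum>g<m. ln (1 + X g (\<sigma> g) k)) \<le> ln (real (card K))" .
    moreover have "(\<Sum>g<m. X g (\<sigma> g) k - \<epsilon>\<^sup>2 / 8) \<le> (\<Sum>g<m. ln (1 + X g (\<sigma> g) k))"
    proof (intro sum_mono)
      fix g assume "g \<in> {..<m}"
      then have x: "\<bar>X g (\<sigma> g) k\<bar> \<le> \<epsilon> / 4" using absX \<sigma> k by auto
      then have "(X g (\<sigma> g) k)\<^sup>2 \<le> (\<epsilon> / 4)\<^sup>2" using \<epsilon> by (simp add: abs_le_square_iff[symmetric])
      moreover have "\<bar>ln (1 + X g (\<sigma> g) k) - X g (\<sigma> g) k\<bar> \<le> 2 * (X g (\<sigma> g) k)\<^sup>2"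
        using x \<epsilon> by (intro abs_ln_one_plus_x_minus_x_bound) linarith
      ultimately show "X g (\<sigma> g) k - \<epsilon>\<^sup>2 / 8 \<le> ln (1 + X g (\<sigma> g) k)"
        by (simp add: power_divide)
    qed
    moreover have "(\<Sum>g<m. X g (\<sigma> g) k - \<epsilon>\<^sup>2 / 8)
        = \<epsilon> / 4 * ((\<Sum>g<m. \<mu> g k) - (\<Sum>g<m. a g (\<sigma> g) k)) - real m * \<epsilon>\<^sup>2 / 8"
      by (simp only: X_def sum_subtractf sum_distrib_left[symmetric]) simp
    ultimately have "\<epsilon> / 4 * ((\<Sum>g<m. \<mu> g k) - (\<Sum>g<m. a g (\<sigma> g) k)) \<le> \<epsilon> / 4 * (\<epsilon> * real m)"
      using large by (simp add: power2_eq_square algebra_simps)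
    then show ?thesis using \<epsilon> by simp
  qed
  with \<sigma> show ?thesis by blast
qed

section \<open>Splitting the vertices and assembling a heavy factor\<close>

lemma bij_betw_add_mod:
  fixes s r :: nat
  shows "bij_betw (\<lambda>j. (s + j) mod r) {..<r} {..<r}"
proof -
  have *: "i = j" if "i \<le> j" "j < r" "(s + i) mod r = (s + j) mod r" for i j
  proof -
    have "r dvd (s + j) - (s + i)"
      using that by (subst mod_eq_dvd_iff_nat[symmetric]) auto
    then show ?thesis using that by (auto dest: dvd_imp_le)
  qed
  have "inj_on (\<lambda>j. (s + j) mod r) {..<r}"
  proof (rule inj_onI)
    fix i j assume "i \<in> {..<r}" "j \<in> {..<r}" "(s + i) mod r = (s + j) mod r"
    then show "i = j" using *[of i j] *[of j i] by (cases "i \<le> j") auto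
  qed
  moreover have "(\<lambda>j. (s + j) mod r) ` {..<r} \<subseteq> {..<r}" by auto
  ultimately show ?thesis
    by (simp add: bij_betw_def endo_inj_surj)
qed

lemma sum_lessThan_blocks:
  fixes f :: "nat \<Rightarrow> real"
  shows "(\<Sum>g<m. \<Sum>s<r. f (g * r + s)) = (\<Sum>u<m * r. f u)"
proof -
  have "(\<Sum>s<r. f (g * r + s)) = sum f {g * r..<g * r + r}" for g
    using sum.shift_bounds_nat_ivl[of f 0 "g * r" r]
    by (simp add: lessThan_atLeast0 add.commute)
  then show ?thesis by (simp add: sum.nat_group)
qed

text \<open>Vertex \<open>g * r + s\<close> has position \<open>s\<close> in block \<open>g\<close>,
  and the shift \<open>\<sigma> g\<close> sends exactly one vertex of that block to each part. The
  surplus \<open>\<epsilon>\<close> in the degrees pays for the deviation of the split from its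
  mean.\<close>

lemma heavy_clique_factor:
  fixes t \<epsilon> :: real
  assumes "r > 0" "t \<le> 1" "0 < \<epsilon>" "\<epsilon> \<le> 1" and w: "w \<in> edge_weightings (m * r)"
    and deg: "\<And>v. v < m * r \<Longrightarrow> (1/2 + t/2 + \<epsilon>) * real (m * r) \<le> weighted_degree (m * r) w v"
    and large: "8 * ln (real (m * r * r)) \<le> \<epsilon>\<^sup>2 * real m"
  shows "\<exists>F. clique_factor r (m * r) F \<and> (\<forall>C\<in>F. t * real (r choose 2) \<le> clique_weight w C)"
proof -
  let ?W = "edge_val w"
  have vlt: "g * r + s < m * r" if "g < m" "s < r" for g s
  proof -
    have "g * r + s < Suc g * r" using that by simp
    also have "\<dots> \<le> m * r" using that by (intro mult_right_mono) auto
    finally show ?thesis .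
  qed
  \<comment> \<open>One condition for each pair of a vertex and a part, whence the
    \<open>m * r * r\<close> under the logarithm.\<close>
  let ?K = "{..<m * r} \<times> {..<r}"
  have "\<exists>\<sigma>. (\<forall>g<m. \<sigma> g < r) \<and> (\<forall>k\<in>?K. (\<Sum>g<m. (\<Sum>s<r. ?W (fst k) (g * r + s)) / real r) - \<epsilon> * real m
      \<le> (\<Sum>g<m. ?W (fst k) (g * r + (\<sigma> g + snd k) mod r)))"
  proof (rule simultaneous_choice_near_mean[where a = "\<lambda>g s k. ?W (fst k) (g * r + (s + snd k) mod r)"])
    show "finite ?K" "r > 0" "0 < \<epsilon>" "\<epsilon> \<le> 1" using assms by auto
    show "8 * ln (real (card ?K)) \<le> \<epsilon>\<^sup>2 * real m" using large by (simp add: card_cartesian_product)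
    show "0 \<le> ?W (fst k) (g * r + (s + snd k) mod r) \<and> ?W (fst k) (g * r + (s + snd k) mod r) \<le> 1"
      if "g < m" "s < r" "k \<in> ?K" for g s k
      using that vlt \<open>r > 0\<close> by (intro conjI edge_val_bounds[OF w]) auto
    \<comment> \<open>For a fixed part, the \<open>r\<close> shifts run through all positions of the
      block, so the mean is the block average whatever the part is.\<close>
    show "(\<Sum>s<r. ?W (fst k) (g * r + (s + snd k) mod r))
        = real r * ((\<Sum>s<r. ?W (fst k) (g * r + s)) / real r)" for g k
      using sum.reindex_bij_betw[OF bij_betw_add_mod[of "snd k" r], of "\<lambda>s. ?W (fst k) (g * r + s)"]
        \<open>r > 0\<close> by (simp add: add.commute)
  qed
  then obtain \<sigma> where \<sigma>: "\<And>v j. v < m * r \<Longrightarrow> j < r \<Longrightarrow>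
      (\<Sum>g<m. (\<Sum>s<r. ?W v (g * r + s)) / real r) - \<epsilon> * real m
      \<le> (\<Sum>g<m. ?W v (g * r + (\<sigma> g + j) mod r))"
    by fastforce
  define p where "p = (\<lambda>j g. g * r + (\<sigma> g + j) mod r)"
  have plt: "p j g < m * r" if "g < m" for j g
    unfolding p_def using that \<open>r > 0\<close> by (intro vlt) auto
  have pdeg: "(1/2 + t/2) * real m \<le> (\<Sum>h<m. ?W v (p j h))" if "v < m * r" "j < r" for v j
  proof -
    have "(\<Sum>g<m. (\<Sum>s<r. ?W v (g * r + s)) / real r) = weighted_degree (m * r) w v / real r"
      using that by (simp add: sum_divide_distrib[symmetric] sum_lessThan_blocks
          weighted_degree_eq_sum_edge_val)
    moreover have "(1/2 + t/2 + \<epsilon>) * real m \<le> weighted_degree (m * r) w v / real r"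
      using deg[OF that(1)] \<open>r > 0\<close> by (simp add: field_simps)
    ultimately show ?thesis using \<sigma>[OF that] by (simp add: p_def algebra_simps)
  qed
  have "\<exists>q. (\<forall>j<r. q j permutes {..<m}) \<and>
    (\<forall>j<r. \<forall>i<m. t * real j \<le> (\<Sum>l<j. ?W (p j (q j i)) (p l (q l i))))"
    using plt assms(2)
    by (intro transversal_cliques[where r = r] edge_val_commute pdeg edge_val_bounds[OF w]) auto
  then obtain q where q: "\<And>j. j < r \<Longrightarrow> q j permutes {..<m}"
    and qW: "\<And>j i. j < r \<Longrightarrow> i < m \<Longrightarrow> t * real j \<le> (\<Sum>l<j. ?W (p j (q j i)) (p l (q l i)))"
    by blast
  define c where "c = (\<lambda>i j. p j (q j i))"
  have qm: "q j i < m" if "j < r" "i < m" for i j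
    using permutes_in_image[OF q[OF that(1)], of i] that(2) by simp
  \<comment> \<open>Decoding a vertex: its quotient by \<open>r\<close> is the block
    \<open>q j i\<close>, its remainder then gives \<open>j\<close> since a cyclic shift is
    injective, and \<open>q j\<close> being injective gives \<open>i\<close>.\<close>
  have c_eq: "i = i' \<and> j = j'" if "c i j = c i' j'" "i < m" "i' < m" "j < r" "j' < r" for i j i' j'
  proof -
    have "q j i = c i j div r" "q j' i' = c i' j' div r"
      using \<open>r > 0\<close> by (simp_all add: c_def p_def)
    then have 1: "q j i = q j' i'" using that(1) by simp
    then have "(\<sigma> (q j i) + j) mod r = (\<sigma> (q j i) + j') mod r"
      using that(1) by (simp add: c_def p_def)
    then have 2: "j = j'"
      using inj_onD[OF bij_betw_imp_inj_on[OF bij_betw_add_mod]] that by blast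
    then have "i = i'" using 1 permutes_inj[OF q[OF that(4)]] by (simp add: inj_eq)
    with 2 show ?thesis by blast
  qed
  have c_surj: "\<exists>i<m. \<exists>j<r. v = c i j" if "v < m * r" for v
  proof -
    let ?g = "v div r"
    have g: "?g < m" using that by (simp add: less_mult_imp_div_less)
    have "v mod r \<in> (\<lambda>j. (\<sigma> ?g + j) mod r) ` {..<r}"
      using bij_betw_imp_surj_on[OF bij_betw_add_mod[of "\<sigma> ?g" r]] \<open>r > 0\<close> by simp
    then obtain j where j: "j < r" "v mod r = (\<sigma> ?g + j) mod r" by auto
    have "?g \<in> q j ` {..<m}" using permutes_image[OF q[OF j(1)]] g by simp
    then obtain i where i: "i < m" "?g = q j i" by auto
    have "v = c i j"
      unfolding c_def p_def i(2)[symmetric] j(2)[symmetric] by simp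
    then show ?thesis using i j by blast
  qed
  define F where "F = (\<lambda>i. c i ` {..<r}) ` {..<m}"
  have inj: "inj_on (c i) {..<r}" if "i < m" for i
    using that by (intro inj_onI) (auto dest: c_eq)
  have "partition_on {..<m * r} F"
  proof (rule partition_onI)
    show "\<Union>F = {..<m * r}"
    proof
      show "\<Union>F \<subseteq> {..<m * r}" using plt qm by (auto simp: F_def c_def)
      show "{..<m * r} \<subseteq> \<Union>F" using c_surj by (fastforce simp: F_def)
    qed
    show "{} \<notin> F"
      using \<open>r > 0\<close> by (auto simp: F_def)
    show "disjnt C D" if "C \<in> F" "D \<in> F" "C \<noteq> D" for C D
    proof -
      obtain i i' where i: "i < m" "C = c i ` {..<r}" "i' < m" "D = c i' ` {..<r}"
        using \<open>C \<in> F\<close> \<open>D \<in> F\<close> by (auto simp: F_def)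
      with \<open>C \<noteq> D\<close> have "i \<noteq> i'" by auto
      then show ?thesis using i by (auto simp: disjnt_iff dest: c_eq)
    qed
  qed
  moreover have "\<forall>C\<in>F. card C = r"
    using inj by (auto simp: F_def card_image)
  moreover have "t * real (r choose 2) \<le> clique_weight w C" if C: "C \<in> F" for C
  proof -
    obtain i where i: "i < m" "C = c i ` {..<r}" using C by (auto simp: F_def)
    \<comment> \<open>The gains \<open>t * j\<close> over \<open>j < r\<close> add up to
      \<open>t * (r choose 2)\<close>.\<close>
    have "(\<Sum>j<r. t * real j) \<le> (\<Sum>j<r. \<Sum>l<j. ?W (c i j) (c i l))"
      using qW i(1) by (intro sum_mono) (auto simp: c_def)
    also have "\<dots> = clique_weight w C"
      using clique_weight_image[OF inj[OF i(1)]] i(2) by simp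
    finally have "t * real (\<Sum>j<r. j) \<le> clique_weight w C"
      by (simp add: sum_distrib_left)
    moreover have "(\<Sum>j<r. j) = r choose 2"
      by (simp add: lessThan_atLeast0 Sum_Ico_nat choose_two)
    ultimately show ?thesis by simp
  qed
  ultimately show ?thesis by (auto simp: clique_factor_def)
qed

section \<open>Bounds for a fixed number of vertices\<close>

lemma delta_n_upper_bound:
  assumes "r \<ge> 2" "0 < t" "t \<le> 1" "0 < \<epsilon>" "\<epsilon> \<le> 1" "m > 0"
    and large: "8 * ln (real (m * r * r)) \<le> \<epsilon>\<^sup>2 * real m"
  shows "delta_n r t (m * r) \<le> (1/2 + t/2 + \<epsilon>) * real (m * r)"
  unfolding delta_n_def
proof (rule cSUP_least)
  show "bad_weightings r t (m * r) \<noteq> {}"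
    using assms by (intro bad_weightings_nonempty) auto
  fix w assume bad: "w \<in> bad_weightings r t (m * r)"
  show "min_weighted_degree (m * r) w \<le> (1/2 + t/2 + \<epsilon>) * real (m * r)"
  proof (rule ccontr)
    assume less: "\<not> ?thesis"
    have "(1/2 + t/2 + \<epsilon>) * real (m * r) \<le> weighted_degree (m * r) w v" if "v < m * r" for v
    proof -
      have "min_weighted_degree (m * r) w \<le> weighted_degree (m * r) w v"
        unfolding min_weighted_degree_def using that by (intro Min_le) auto
      with less show ?thesis by linarith
    qed
    then have "\<exists>F. clique_factor r (m * r) F \<and> (\<forall>C\<in>F. t * real (r choose 2) \<le> clique_weight w C)"
      using assms bad by (intro heavy_clique_factor[where \<epsilon> = \<epsilon>]) (auto simp: bad_weightings_def)
    with bad show False by (fastforce simp: bad_weightings_def)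
  qed
qed

text \<open>The left side is the degree of a vertex outside the special set \<open>B\<close>: weight
  1 to each of the \<open>m - 1\<close> vertices of \<open>B\<close> and weight \<open>s\<close> to
  the other \<open>m * r - m\<close> vertices. Vertices of \<open>B\<close> have degree
  \<open>m * r - 1\<close>, which is no smaller.\<close>

lemma delta_n_lower_bound:
  assumes "r \<ge> 2" "0 < t" "t \<le> 1" "m > 0"
  shows "real m - 1 + t * (1 - 1 / real m) * real (m * r - m) \<le> delta_n r t (m * r)"
proof -
  define n where "n = m * r"
  \<comment> \<open>Bad weightings need a clique strictly lighter than the threshold, so
    \<open>s\<close> stays below \<open>t\<close>; the factor \<open>1 - 1 / m\<close> tends to 1
    and is lost in the limit.\<close>
  define s where "s = t * (1 - 1 / real m)"
  define B where "B = {..<m - 1}"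
  define w where "w = (\<lambda>e\<in>nsets {..<n} 2. if e \<inter> B = {} then s else 1 :: real)"
  have n: "n > 0" "m \<le> n" using assms by (auto simp: n_def)
  have s: "0 \<le> s" "s < t" using assms by (auto simp: s_def field_simps)
  with assms have s1: "s \<le> 1" by simp
  have w_edge: "w \<in> edge_weightings n"
    using s s1 by (auto simp: w_def edge_weightings_def)
  have "w \<in> bad_weightings r t n"
    unfolding bad_weightings_def
  proof (intro CollectI conjI allI impI w_edge)
    fix F assume F: "clique_factor r n F"
    then have U: "\<Union>F = {..<n}" and disj: "disjoint F" and card: "\<And>C. C \<in> F \<Longrightarrow> card C = r"
      by (auto simp: clique_factor_def partition_on_def)
    have "card (\<Union>F) = (\<Sum>C\<in>F. card C)"
      using disj card assms(1)
      by (intro card_Union_disjoint)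
        (auto simp: pairwise_def disjoint_def disjnt_def intro: card_ge_0_finite)
    then have cF: "card F = m" using U card assms by (simp add: n_def)
    \<comment> \<open>Pigeonhole: the \<open>m\<close> cliques are disjoint, so the
      \<open>m - 1\<close> vertices of \<open>B\<close> cannot meet all of them.\<close>
    have "\<exists>C\<in>F. C \<inter> B = {}"
    proof (rule ccontr)
      assume "\<not> ?thesis"
      then have "\<forall>C\<in>F. \<exists>b. b \<in> C \<inter> B" by blast
      then obtain b where b: "\<And>C. C \<in> F \<Longrightarrow> b C \<in> C \<inter> B" by metis
      have "inj_on b F"
      proof (rule inj_onI, rule ccontr)
        fix C D assume CD: "C \<in> F" "D \<in> F" "b C = b D" "C \<noteq> D"
        then have "C \<inter> D = {}" using disj by (auto simp: disjoint_def)
        then show False using b[of C] b[of D] CD by auto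
      qed
      then have "card F \<le> card B" using b by (intro card_inj_on_le[of b]) (auto simp: B_def)
      then show False using cF assms by (simp add: B_def)
    qed
    then obtain C where C: "C \<in> F" "C \<inter> B = {}" by blast
    have sub: "nsets C 2 \<subseteq> nsets {..<n} 2" using C U by (intro nsets_mono) auto
    have "w e = s" if "e \<in> nsets C 2" for e
    proof -
      have "e \<inter> B = {}" using that C(2) by (auto simp: nsets_def)
      then show ?thesis using that sub by (auto simp: w_def)
    qed
    then have "clique_weight w C = real (r choose 2) * s"
      using card[OF C(1)] by (simp add: clique_weight_def)
    also have "\<dots> < t * real (r choose 2)"
      using s assms by (simp add: mult.commute zero_less_binomial_iff)
    finally show "\<exists>C\<in>F. clique_weight w C < t * real (r choose 2)" using C(1) by blast
  qed
  then have le: "min_weighted_degree n w \<le> delta_n r t n"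
    unfolding delta_n_def using bdd_above_min_weighted_degree[OF n(1)] by (rule cSUP_upper)
  have "real m - 1 + s * real (n - m) \<le> weighted_degree n w v" if v: "v < n" for v
  proof -
    have w_val: "edge_val w v u = (if v = u then 0 else if u \<in> B \<or> v \<in> B then 1 else s)"
      if "u < n" for u
      using that v by (auto simp: edge_val_def w_def nsets_def)
    have B: "B \<subseteq> {..<n}" "card B = m - 1" "finite B" using n by (auto simp: B_def)
    \<comment> \<open>For \<open>v\<close> outside \<open>B\<close> this is
      \<open>edge_val w v\<close>, written as a function of two values on all vertices minus its
      diagonal entry.\<close>
    let ?f = "\<lambda>u. (if u \<in> B then 1 else s) - (if u = v then (if v \<in> B then 1 else s) else 0)"
    have "(\<Sum>u<n. ?f u) = (\<Sum>u<n. if u \<in> B then 1 else s) - (if v \<in> B then 1 else s)"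
      using v by (simp add: sum_subtractf)
    also have "(\<Sum>u<n. if u \<in> B then 1 else s) = real (m - 1) + s * real (n - (m - 1))"
    proof -
      have "{..<n} \<inter> B = B" "card ({..<n} \<inter> - B) = n - (m - 1)"
        using B card_Diff_subset[of B "{..<n}"] by (auto simp: Diff_eq)
      then show ?thesis using B by (simp add: sum.If_cases)
    qed
    finally have eq: "(\<Sum>u<n. ?f u) = real (m - 1) + s * real (n - (m - 1)) - (if v \<in> B then 1 else s)" .
    show ?thesis
    proof (cases "v \<in> B")
      case True
      have "(\<Sum>u<n. edge_val w v u) = (\<Sum>u<n. 1 - (if u = v then 1 else 0))"
        using True by (intro sum.cong) (auto simp: w_val)
      also have "\<dots> = real n - 1" using v by (simp add: sum_subtractf)
      finally have "weighted_degree n w v = real n - 1"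
        using v by (simp add: weighted_degree_eq_sum_edge_val)
      moreover have "s * real (n - m) \<le> real (n - m)"
        using s s1 by (simp add: mult_left_le_one_le)
      ultimately show ?thesis using n by (simp add: of_nat_diff)
    next
      case False
      have "(\<Sum>u<n. edge_val w v u) = (\<Sum>u<n. ?f u)"
        using False by (intro sum.cong) (auto simp: w_val)
      also have "\<dots> = real m - 1 + s * real (n - m)"
        unfolding eq using False n assms(4) by (simp add: of_nat_diff algebra_simps)
      finally show ?thesis using v by (simp add: weighted_degree_eq_sum_edge_val)
    qed
  qed
  then have "real m - 1 + s * real (n - m) \<le> min_weighted_degree n w"
    unfolding min_weighted_degree_def using n by (subst Min_ge_iff) auto
  with le show ?thesis by (simp add: n_def s_def)
qed

section \<open>Passage to the limit superior\<close>

text \<open>A limit determines the \<open>Limsup\<close> only along a nontrivial filter.\<close>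

lemma multiples_filter_neq_bot:
  assumes "r > 0"
  shows "inf sequentially (principal {n. r dvd n}) \<noteq> bot"
proof
  assume "inf sequentially (principal {n. r dvd n}) = bot"
  then have "eventually (\<lambda>n. \<not> r dvd n) sequentially"
    by (simp add: trivial_limit_def eventually_inf_principal)
  then obtain N where "\<And>n. n \<ge> N \<Longrightarrow> \<not> r dvd n" by (auto simp: eventually_sequentially)
  from this[of "N * r"] show False using assms by simp
qed

lemma delta_lower_bound:
  assumes "r \<ge> 2" "0 < t" "t \<le> 1"
  shows "ereal (1 / real r + (1 - 1 / real r) * t) \<le> delta r t"
proof -
  let ?F = "inf sequentially (principal {n. r dvd n})"
  \<comment> \<open>The bound of \<open>delta_n_lower_bound\<close> divided by \<open>n\<close>,
    with \<open>m\<close> replaced by \<open>n / r\<close> so that it makes sense and converges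
    along all \<open>n\<close>.\<close>
  define f where "f = (\<lambda>n::nat. 1 / real r - 1 / real n + t * (1 - real r / real n) * (1 - 1 / real r))"
  have "f \<longlonglongrightarrow> 1 / real r - 0 + t * (1 - 0) * (1 - 1 / real r)"
    unfolding f_def by (intro tendsto_intros lim_const_over_n lim_1_over_n)
  then have "(f \<longlongrightarrow> 1 / real r + (1 - 1 / real r) * t) ?F"
    by (intro tendsto_mono[OF inf_le1]) (simp add: mult.commute)
  then have "Limsup ?F (\<lambda>n. ereal (f n)) = ereal (1 / real r + (1 - 1 / real r) * t)"
    using assms by (intro lim_imp_Limsup multiples_filter_neq_bot) auto
  moreover have "Limsup ?F (\<lambda>n. ereal (f n)) \<le> delta r t"
    unfolding delta_def
  proof (rule Limsup_mono)
    show "eventually (\<lambda>n. ereal (f n) \<le> ereal (delta_n r t n / real n)) ?F"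
      unfolding eventually_inf_principal using eventually_gt_at_top[of 0]
    proof eventually_elim
      case (elim n)
      show ?case
      proof
        assume "n \<in> {n. r dvd n}"
        then obtain m where m: "n = m * r" by (auto simp: dvd_def mult.commute)
        then have pos: "m > 0" "r > 0" using elim by auto
        have "f n * real n = real m - 1 + t * (1 - 1 / real m) * real (m * r - m)"
          using pos by (simp add: f_def m of_nat_diff field_simps)
        also have "\<dots> \<le> delta_n r t n"
          unfolding m using assms pos by (intro delta_n_lower_bound) auto
        finally show "ereal (f n) \<le> ereal (delta_n r t n / real n)"
          using elim by (simp add: field_simps)
      qed
    qed
  qed
  ultimately show ?thesis by simp
qed

lemma delta_upper_bound:
  assumes "r \<ge> 2" "0 < t" "t \<le> 1"
  shows "delta r t \<le> ereal (1 / 2 + t / 2)"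
proof (rule ereal_le_epsilon2)
  fix e :: real assume "0 < e"
  \<comment> \<open>The cap at 1 meets the condition \<open>\<epsilon> \<le> 1\<close> of
    \<open>delta_n_upper_bound\<close>.\<close>
  define \<epsilon> where "\<epsilon> = min e 1"
  have \<epsilon>: "0 < \<epsilon>" "\<epsilon> \<le> 1" "\<epsilon> \<le> e" using \<open>0 < e\<close> by (auto simp: \<epsilon>_def)
  have r: "real r > 0" using assms by simp
  \<comment> \<open>For \<open>n = m * r\<close> this is the size condition \<open>large\<close>: a
    logarithm against a linear function.\<close>
  have "eventually (\<lambda>n. 8 * ln (real n * real r) \<le> \<epsilon>\<^sup>2 * (real n / real r)) sequentially"
    using \<epsilon>(1) r by real_asymp
  then have "eventually (\<lambda>n. r dvd n \<longrightarrow> delta_n r t n / real n \<le> 1 / 2 + t / 2 + e) sequentially"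
    using eventually_gt_at_top[of 0]
  proof eventually_elim
    case (elim n)
    show ?case
    proof
      assume "r dvd n"
      then obtain m where m: "n = m * r" by (auto simp: dvd_def mult.commute)
      then have pos: "m > 0" "r > 0" using elim by auto
      have "delta_n r t n \<le> (1/2 + t/2 + \<epsilon>) * real n"
        unfolding m using assms pos \<epsilon> elim by (intro delta_n_upper_bound) (auto simp: m)
      then have "delta_n r t n / real n \<le> 1/2 + t/2 + \<epsilon>"
        using elim by (simp add: pos_divide_le_eq)
      then show "delta_n r t n / real n \<le> 1 / 2 + t / 2 + e" using \<epsilon> by linarith
    qed
  qed
  then show "delta r t \<le> ereal (1 / 2 + t / 2) + ereal e"
    unfolding delta_def by (intro Limsup_bounded) (simp add: eventually_inf_principal)
qed

theorem theorem7:
  fixes r :: nat and t :: real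
  assumes "r \<ge> 3" and "0 < t" and "t \<le> 1"
  shows "ereal (1 / real r + (1 - 1 / real r) * t) \<le> delta r t
    \<and> delta r t \<le> ereal (1 / 2 + t / 2)"
  using assms by (intro conjI delta_lower_bound delta_upper_bound) auto

end
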